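(* Let $C_n$ ($n\ge 3$) be the cycle on $n$ vertices. Then $\mathrm{USN}(C_n) = O(\log n)$ as $n\to\infty$; that is, there exist constants $K>0$ and $n_0$ such that $\mathrm{USN}(C_n)\le K\log n$ for all $n\ge n_0$.
   Context: Graphs are finite, simple and undirected. A valid labelling of a graph $G$ with universe a finite set $S$ assigns to the vertices of $G$ pairwise distinct nonempty subsets of $S$ such that two distinct vertices are adjacent if and only if their labels are disjoint. The universe size number $\mathrm{USN}(G)$ is the minimum of $|S|$ over all finite sets $S$ for which $G$ has a valid labelling with universe $S$. *)

theory Defs
  imports Complex_Main "Graph_Theory.Pair_Digraph"
begin

text \<open>
  A finite simple undirected graph is a \<^locale>\<open>pair_graph\<close>: a finite vertex set with a symmetric,
  irreflexive set of arcs, so that \<open>u\<close> and \<open>v\<close> are adjacent iff \<open>(u, v) \<in> parcs G\<close>.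
\<close>

definition valid_labelling :: "'a pair_pre_digraph \<Rightarrow> 'b set \<Rightarrow> ('a \<Rightarrow> 'b set) \<Rightarrow> bool" where
  "valid_labelling G S f \<longleftrightarrow>
     finite S \<and>
     (\<forall>v \<in> pverts G. f v \<noteq> {} \<and> f v \<subseteq> S) \<and>
     inj_on f (pverts G) \<and>
     (\<forall>u \<in> pverts G. \<forall>v \<in> pverts G. u \<noteq> v \<longrightarrow> ((u, v) \<in> parcs G \<longleftrightarrow> f u \<inter> f v = {}))"

text \<open>
  The minimum is taken over universes of natural numbers. This loses nothing
  (\<open>valid_labelling_transfer\<close>), and every graph has a valid labelling
  (\<open>ex_valid_labelling\<close>), so the minimum is attained.
\<close>

definition USN :: "'a pair_pre_digraph \<Rightarrow> nat" where
  "USN G = (LEAST k. \<exists>(S :: nat set) f. valid_labelling G S f \<and> card S = k)"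

definition cycle_graph :: "nat \<Rightarrow> nat pair_pre_digraph" where
  "cycle_graph n =
     \<lparr> pverts = {..<n},
       parcs = {(i, j). i < n \<and> j < n \<and> (j = (i + 1) mod n \<or> i = (j + 1) mod n)} \<rparr>"

lemma pair_graph_cycle_graph:
  assumes "n \<ge> 3"
  shows "pair_graph (cycle_graph n)"
proof
  show "finite (pverts (cycle_graph n))"
    by (simp add: cycle_graph_def)
  show "finite (parcs (cycle_graph n))"
    by (rule finite_subset[of _ "{..<n} \<times> {..<n}"]) (auto simp: cycle_graph_def)
  show "fst e \<noteq> snd e" if "e \<in> parcs (cycle_graph n)" for e
    using that assms by (auto simp: cycle_graph_def mod_Suc split: if_splits)
  show "symmetric (with_proj (cycle_graph n))"
    by (auto simp: cycle_graph_def symmetric_def arcs_ends_conv intro!: symI)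
qed (auto simp: cycle_graph_def)

lemma valid_labelling_transfer:
  fixes S :: "'b set" and T :: "'c set"
  assumes "valid_labelling G S f" and "finite T" and "card T = card S"
  shows "\<exists>g. valid_labelling G T g"
proof -
  from assms obtain h where h: "bij_betw h S T"
    by (metis finite_same_card_bij valid_labelling_def)
  have inj: "inj_on h S" and im: "h ` S = T"
    using h by (auto simp: bij_betw_def)
  have sub: "f v \<subseteq> S" if "v \<in> pverts G" for v
    using assms(1) that by (auto simp: valid_labelling_def)
  have eq: "h ` f u = h ` f v \<longleftrightarrow> f u = f v"
    if "u \<in> pverts G" "v \<in> pverts G" for u v
    using inj_on_image_eq_iff[OF inj sub sub] that by blast
  have disj: "h ` f u \<inter> h ` f v = {} \<longleftrightarrow> f u \<inter> f v = {}"
    if "u \<in> pverts G" "v \<in> pverts G" for u v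
    using inj_on_image_Int[OF inj sub sub, of u v] that by (metis image_is_empty)
  have "valid_labelling G T (\<lambda>v. h ` f v)"
    unfolding valid_labelling_def
  proof (intro conjI ballI impI)
    show "inj_on (\<lambda>v. h ` f v) (pverts G)"
      using assms(1) by (auto simp: valid_labelling_def inj_on_def eq)
  qed (use assms im sub in \<open>auto simp: valid_labelling_def disj\<close>)
  then show ?thesis by blast
qed

text \<open>Label every vertex with itself and with the non-edges it lies on.\<close>

lemma ex_valid_labelling:
  assumes "pair_graph G"
  shows "\<exists>(S :: nat set) f. valid_labelling G S f"
proof -
  interpret pair_graph G by fact
  have sym: "(u, v) \<in> parcs G \<longleftrightarrow> (v, u) \<in> parcs G" for u v
    using arcs_symmetric by blast
  define f where "f v = insert {v} {{v, w} | w. w \<in> pverts G \<and> w \<noteq> v \<and> (v, w) \<notin> parcs G}" for v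
  have "valid_labelling G (Pow (pverts G)) f"
    unfolding valid_labelling_def
  proof (intro conjI ballI impI)
    show "inj_on f (pverts G)"
      by (auto simp: inj_on_def f_def set_eq_iff) (metis singletonI singletonD insertI1 insertI2)+
    show "((u, v) \<in> parcs G) = (f u \<inter> f v = {})"
      if "u \<in> pverts G" "v \<in> pverts G" "u \<noteq> v" for u v
    proof
      assume "(u, v) \<in> parcs G"
      then show "f u \<inter> f v = {}"
        using that sym by (auto simp: f_def doubleton_eq_iff)
    next
      assume d: "f u \<inter> f v = {}"
      show "(u, v) \<in> parcs G"
      proof (rule ccontr)
        assume "(u, v) \<notin> parcs G"
        with that sym have "{u, v} \<in> f u" "{u, v} \<in> f v"
          by (auto simp: f_def doubleton_eq_iff)
        with d show False by blast
      qed
    qed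
  qed (auto simp: f_def)
  from valid_labelling_transfer[OF this, of "{..<card (Pow (pverts G))}"]
  show ?thesis by auto
qed

end

theory Submission
  imports Defs
begin

text \<open>
  Labelling each vertex with the members of a family of independent sets that contain it turns
  the problem into covering every non-adjacent pair of vertices by an independent set.
  For paths such families arise by folding: \<open>x \<mapsto> \<bar>x - m\<bar>\<close> maps the path on \<open>0, \<dots>, 2m\<close>
  homomorphically onto the path on \<open>0, \<dots>, m\<close>, and preimages of independent sets under a
  homomorphism are independent. The only non-adjacent pairs that fail to be covered by preimages
  lie on different sides of \<open>m\<close> and have different parity, and two more independent sets
  take care of them. So doubling the length costs two sets. A cycle is a path plus one vertex, whose
  non-neighbours are covered by another two sets.
\<close>

text \<open>Each vertex is labelled by the sets of \<open>F\<close> that contain it. Equal labels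
  would force equal neighbourhoods, which \<open>twinfree\<close> excludes; \<open>cover\<close>
  with \<open>u = v\<close> makes the labels nonempty.\<close>

lemma USN_le_card_cover:
  fixes F :: "'a set set"
  assumes fin: "finite F"
    and indep: "\<And>I u v. \<lbrakk>I \<in> F; u \<in> I; v \<in> I\<rbrakk> \<Longrightarrow> (u, v) \<notin> parcs G"
    and cover: "\<And>u v. \<lbrakk>u \<in> pverts G; v \<in> pverts G; (u, v) \<notin> parcs G\<rbrakk> \<Longrightarrow> \<exists>I\<in>F. u \<in> I \<and> v \<in> I"
    and loopfree: "\<And>v. (v, v) \<notin> parcs G"
    and twinfree: "\<And>u v. \<lbrakk>u \<in> pverts G; v \<in> pverts G; u \<noteq> v\<rbrakk>
      \<Longrightarrow> \<exists>w\<in>pverts G. (w, u) \<in> parcs G \<longleftrightarrow> (w, v) \<notin> parcs G"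
  shows "USN G \<le> card F"
proof -
  define f where "f v = {I \<in> F. v \<in> I}" for v
  have disj: "f u \<inter> f v = {} \<longleftrightarrow> (u, v) \<in> parcs G" if "u \<in> pverts G" "v \<in> pverts G" for u v
    using indep cover[OF that] by (auto simp: f_def)
  have "valid_labelling G F f"
    unfolding valid_labelling_def
  proof (intro conjI ballI impI)
    show "f v \<noteq> {}" if "v \<in> pverts G" for v
      using disj[OF that that] loopfree by blast
    show "inj_on f (pverts G)"
      using disj twinfree by (metis inj_onI)
  qed (use fin disj in \<open>auto simp: f_def\<close>)
  from valid_labelling_transfer[OF this, of "{..<card F}"]
  obtain g where "valid_labelling G {..<card F} g"
    by auto
  then show ?thesis
    unfolding USN_def by (intro Least_le) (metis card_lessThan)
qed

text \<open>The path has vertices \<open>0, ..., 2 ^ k\<close>, one more than a power of two, so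
  that the next path, folded at its midpoint \<open>2 ^ k\<close>, has both halves mapped onto this
  one.\<close>

lemma path_independent_cover:
  "\<exists>F :: nat set set. finite F \<and> card F \<le> 2 * k + 2 \<and> (\<forall>I\<in>F. \<forall>x\<in>I. Suc x \<notin> I) \<and>
    (\<forall>x y. x \<le> y \<longrightarrow> y \<le> 2 ^ k \<longrightarrow> y \<noteq> Suc x \<longrightarrow> (\<exists>I\<in>F. x \<in> I \<and> y \<in> I))"
proof (induction k)
  case 0
  have "\<exists>I\<in>{{0}, {1}}. x \<in> I \<and> y \<in> I" if "x \<le> y" "y \<le> 1" "y \<noteq> Suc x" for x y :: nat
    using that by (cases "y = 0") auto
  then show ?case
    by (intro exI[of _ "{{0}, {1}}"]) auto
next
  case (Suc k)
  then obtain F :: "nat set set" where fin: "finite F" and card: "card F \<le> 2 * k + 2"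
    and indep: "\<And>I x. \<lbrakk>I \<in> F; x \<in> I\<rbrakk> \<Longrightarrow> Suc x \<notin> I"
    and cover: "\<And>x y. \<lbrakk>x \<le> y; y \<le> 2 ^ k; y \<noteq> Suc x\<rbrakk> \<Longrightarrow> \<exists>I\<in>F. x \<in> I \<and> y \<in> I"
    by metis
  define m :: nat where "m = 2 ^ k"
  define h where "h x = (if x \<le> m then m - x else x - m)" for x
  \<comment> \<open>The parity flips at \<open>m\<close>. Since \<open>m\<close> itself is left out,
    no edge joins the two halves, so the set is independent.\<close>
  define B where "B r = {x. x < m \<and> x mod 2 = r \<or> m < x \<and> x mod 2 \<noteq> r}" for r
  define F' where "F' = {B 0, B 1} \<union> (\<lambda>I. h -` I) ` F"
  have "card F' \<le> 2 + card F"
    unfolding F'_def using card_Un_le[of "{B 0, B 1}" "(\<lambda>I. h -` I) ` F"]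
      card_image_le[OF fin, of "\<lambda>I. h -` I"] card_insert_le_m1[of 2 "{B 1}" "B 0"] by simp
  then have "card F' \<le> 2 * Suc k + 2"
    using card by simp
  moreover have "Suc x \<notin> I" if "I \<in> F'" "x \<in> I" for I x
  proof -
    have "h (Suc x) = Suc (h x) \<or> h x = Suc (h (Suc x))"
      by (auto simp: h_def)
    moreover have "Suc x \<notin> B r" if "x \<in> B r" "r < 2" for r
      using that by (auto simp: B_def mod_Suc)
    ultimately show ?thesis
      using that indep by (auto simp: F'_def)
  qed
  moreover have "\<exists>I\<in>F'. x \<in> I \<and> y \<in> I" if xy: "x \<le> y" "y \<le> 2 * m" "y \<noteq> Suc x" for x y
  proof (cases "h x = Suc (h y) \<or> h y = Suc (h x)")
    case True
    \<comment> \<open>Within one side, \<open>m\<close> included, folding preserves distances, so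
      \<open>x\<close> and \<open>y\<close> would be consecutive. Hence they lie strictly on
      opposite sides, at distances from \<open>m\<close> that differ by one.\<close>
    then have "x < m" "m < y" "x + y = 2 * m + 1 \<or> x + y + 1 = 2 * m"
      using xy by (auto simp: h_def split: if_splits)
    moreover from this(3) have "x mod 2 \<noteq> y mod 2"
      by presburger
    ultimately have "x \<in> B (x mod 2)" "y \<in> B (x mod 2)"
      by (auto simp: B_def)
    moreover have "B (x mod 2) \<in> F'"
      by (cases "x mod 2 = 0") (auto simp: F'_def)
    ultimately show ?thesis
      by blast
  next
    case False
    have "h x \<le> m" "h y \<le> m"
      using xy by (auto simp: h_def)
    then obtain I where "I \<in> F" "h x \<in> I" "h y \<in> I"
      using False cover[of "h x" "h y"] cover[of "h y" "h x"] by (metis m_def nat_le_linear)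
    then show ?thesis
      by (auto simp: F'_def)
  qed
  ultimately show ?case
    using fin by (intro exI[of _ F']) (auto simp: F'_def m_def)
qed

lemma parcs_cycle_graph_less:
  assumes "u < v" "v < n" "n \<ge> 3"
  shows "(u, v) \<in> parcs (cycle_graph n) \<longleftrightarrow> v = Suc u \<or> u = 0 \<and> Suc v = n"
  using assms by (auto simp: cycle_graph_def mod_Suc)

lemma parcs_cycle_graph_sym:
  "(u, v) \<in> parcs (cycle_graph n) \<longleftrightarrow> (v, u) \<in> parcs (cycle_graph n)"
  by (auto simp: cycle_graph_def)

lemma parcs_cycle_graph_irrefl:
  "n \<ge> 3 \<Longrightarrow> (v, v) \<notin> parcs (cycle_graph n)"
  by (auto simp: cycle_graph_def mod_Suc)

text \<open>False for \<open>n = 4\<close>, where opposite vertices have the same neighbours.\<close>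

lemma cycle_graph_twinfree:
  assumes n: "n \<ge> 5" and uv: "u < v" "v < n"
  shows "\<exists>w<n. (w, u) \<in> parcs (cycle_graph n) \<longleftrightarrow> (w, v) \<notin> parcs (cycle_graph n)"
proof -
  consider "v = Suc u" | "v = u + 2" "Suc v < n" | "v = u + 2" "Suc v = n" | "v \<ge> u + 3"
    using uv by linarith
  then show ?thesis
  proof cases
    case 1
    then show ?thesis
      using uv n parcs_cycle_graph_less[of u v n] parcs_cycle_graph_irrefl[of n u]
      by (intro exI[of _ u]) auto
  next
    case 2
    then show ?thesis
      using uv n parcs_cycle_graph_less[of u "Suc v" n] parcs_cycle_graph_less[of v "Suc v" n]
        parcs_cycle_graph_sym[of "Suc v" u n] parcs_cycle_graph_sym[of "Suc v" v n]
      by (intro exI[of _ "Suc v"]) auto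
  next
    \<comment> \<open>Here \<open>u = n - 3\<close>, and \<open>n \<ge> 5\<close> gives
      \<open>u - 1 \<ge> 1\<close>, so the witness \<open>u - 1\<close> differs from
      \<open>0\<close>, the neighbour of \<open>v = n - 1\<close> across the closing edge.\<close>
    case 3
    then show ?thesis
      using uv n parcs_cycle_graph_less[of "u - 1" u n] parcs_cycle_graph_less[of "u - 1" v n]
      by (intro exI[of _ "u - 1"]) auto
  next
    case 4
    then show ?thesis
      using uv n parcs_cycle_graph_less[of u "Suc u" n] parcs_cycle_graph_less[of "Suc u" v n]
        parcs_cycle_graph_sym[of "Suc u" u n]
      by (intro exI[of _ "Suc u"]) auto
  qed
qed

lemma USN_cycle_graph_le:
  assumes n: "n \<ge> 5" "n \<le> 2 ^ k"
  shows "USN (cycle_graph n) \<le> 2 * k + 4"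
proof -
  let ?E = "parcs (cycle_graph n)"
  obtain F :: "nat set set" where fin: "finite F" and card: "card F \<le> 2 * k + 2"
    and indep: "\<And>I x. \<lbrakk>I \<in> F; x \<in> I\<rbrakk> \<Longrightarrow> Suc x \<notin> I"
    and cover: "\<And>x y. \<lbrakk>x \<le> y; y \<le> 2 ^ k; y \<noteq> Suc x\<rbrakk> \<Longrightarrow> \<exists>I\<in>F. x \<in> I \<and> y \<in> I"
    using path_independent_cover[of k] by metis
  \<comment> \<open>The non-neighbours of \<open>n - 1\<close> are \<open>1, ..., n - 3\<close>;
    splitting them by parity keeps each set independent.\<close>
  define B where "B r = insert (n - 1) {x. 0 < x \<and> x < n - 2 \<and> x mod 2 = r}" for r
  \<comment> \<open>A set in \<open>F\<close> may contain both \<open>0\<close> and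
    \<open>n - 1\<close>, which are adjacent in the cycle; the intersection removes
    \<open>n - 1\<close>.\<close>
  define F' where "F' = {B 0, B 1} \<union> (\<lambda>I. I \<inter> {..<n - 1}) ` F"
  have "card F' \<le> 2 + card F"
    unfolding F'_def using card_Un_le[of "{B 0, B 1}" "(\<lambda>I. I \<inter> {..<n - 1}) ` F"]
      card_image_le[OF fin, of "\<lambda>I. I \<inter> {..<n - 1}"] card_insert_le_m1[of 2 "{B 1}" "B 0"] by simp
  moreover have "USN (cycle_graph n) \<le> card F'"
  proof (rule USN_le_card_cover)
    show "finite F'"
      using fin by (simp add: F'_def)
    show "(v, v) \<notin> ?E" for v
      using n parcs_cycle_graph_irrefl by simp
  next
    have less: "(u, v) \<notin> ?E" if "I \<in> F'" "u \<in> I" "v \<in> I" "u < v" for I u v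
    proof -
      have "v < n"
        using that n by (auto simp: F'_def B_def)
      moreover have "v \<noteq> Suc u"
        using that n indep by (auto simp: F'_def B_def mod_Suc)
      moreover have "\<not> (u = 0 \<and> Suc v = n)"
        using that n by (auto simp: F'_def B_def)
      ultimately show ?thesis
        using parcs_cycle_graph_less[OF \<open>u < v\<close>] n by simp
    qed
    show "(u, v) \<notin> ?E" if "I \<in> F'" "u \<in> I" "v \<in> I" for I u v
      using less[OF that] less[OF that(1,3,2)] parcs_cycle_graph_sym[of u v n]
        parcs_cycle_graph_irrefl[of n v] n by (cases u v rule: linorder_cases) auto
  next
    have le: "\<exists>I\<in>F'. u \<in> I \<and> v \<in> I" if uv: "u \<le> v" "v < n" "(u, v) \<notin> ?E" for u v
    proof (cases "v = n - 1")
      case True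
      then have "u \<in> B (u mod 2) \<and> v \<in> B (u mod 2)"
        using uv n parcs_cycle_graph_less[of u v n] by (cases "u = v") (auto simp: B_def)
      moreover have "B (u mod 2) \<in> F'"
        by (cases "u mod 2 = 0") (auto simp: F'_def)
      ultimately show ?thesis
        by blast
    next
      case False
      then have "v \<noteq> Suc u"
        using uv n parcs_cycle_graph_less[of u v n] by auto
      then obtain I where "I \<in> F" "u \<in> I" "v \<in> I"
        using cover[of u v] uv n by auto
      then show ?thesis
        using uv False by (auto simp: F'_def)
    qed
    show "\<exists>I\<in>F'. u \<in> I \<and> v \<in> I"
      if "u \<in> pverts (cycle_graph n)" "v \<in> pverts (cycle_graph n)" "(u, v) \<notin> ?E" for u v
    proof (cases "u \<le> v")
      case True
      then show ?thesis
        using le that by (simp add: cycle_graph_def)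
    next
      case False
      then show ?thesis
        using le[of v u] that parcs_cycle_graph_sym[of u v n] by (auto simp: cycle_graph_def)
    qed
  next
    show "\<exists>w\<in>pverts (cycle_graph n). (w, u) \<in> ?E \<longleftrightarrow> (w, v) \<notin> ?E"
      if "u \<in> pverts (cycle_graph n)" "v \<in> pverts (cycle_graph n)" "u \<noteq> v" for u v
    proof -
      have "pverts (cycle_graph n) = {..<n}"
        by (simp add: cycle_graph_def)
      then show ?thesis
        using that cycle_graph_twinfree[OF n(1), of u v] cycle_graph_twinfree[OF n(1), of v u]
        by (cases u v rule: linorder_cases) auto
    qed
  qed
  ultimately show ?thesis
    using card by linarith
qed

theorem theorem11:
  shows "\<exists>K > 0. \<exists>n0 :: nat. \<forall>n \<ge> 3. n \<ge> n0 \<longrightarrow>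
    real (USN (cycle_graph n)) \<le> K * ln (real n)"
proof (intro exI[of _ "8 / ln 2"] exI[of _ "5 :: nat"] conjI allI impI)
  fix n :: nat
  assume n: "n \<ge> 5"
  then obtain k where k: "2 ^ k \<le> n" "n < 2 ^ (k + 1)"
    using ex_power_ivl1[of 2 n] by auto
  \<comment> \<open>The bound for exponent \<open>k + 1\<close> is
    \<open>2 * (k + 1) + 4 = 2 * k + 6\<close>, at most \<open>8 * k\<close> once
    \<open>k \<ge> 1\<close>; this is the source of the 8.\<close>
  have "k \<noteq> 0"
    using k n by (intro notI) simp
  then have "real (USN (cycle_graph n)) \<le> 8 * real k"
    using USN_cycle_graph_le[of n "k + 1"] n k by simp
  moreover have "real k * ln 2 \<le> ln (real n)"
    using k n by (simp flip: ln_realpow of_nat_power)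
  then have "8 * real k \<le> 8 / ln 2 * ln (real n)"
    by (simp add: field_simps)
  ultimately show "real (USN (cycle_graph n)) \<le> 8 / ln 2 * ln (real n)"
    by linarith
qed simp

end
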